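(* Consider the local search allocation with an arbitrary tie-breaking rule (uniformly at random, or by fixed permutations $\{\xi_v\}_{v\in V}$). (i) For any connected graph on $n$ vertices with maximum degree $\Delta$, the maximum load $X_{\max}^{(n)}$ after $n$ balls are allocated is at least $\Omega\left(\frac{\log\log n}{\log\Delta}\right)$ with probability $1-o(1)$ as $n\to\infty$. (ii) Furthermore, for any integer $d$ with $2\le d\le \frac{\log n}{\mathrm{e}}$, there is a connected $d$-regular graph on $n$ vertices for which the maximum load $X_{\max}^{(n)}$ after $n$ balls are allocated is at least $$\Omega\left(\sqrt{\frac{\log n}{d\cdot\log\left(\frac{\log n}{d}\right)}}\right)$$ with probability $1-o(1)$ as $n\to\infty$.
   Context: Local search allocation on a finite, undirected, connected graph $G=(V,E)$ with $|V|=n$: the vertices are bins, all initially with load $0$. Balls $1,2,\dots$ are allocated one after another. Ball $i$ is born at a vertex $U_i$ (its birthplace), where $U_1,U_2,\dots$ are independent and uniform on $V$. Starting at $U_i$, as long as the current vertex has a neighbor whose load is strictly smaller than the load of the current vertex, the ball moves to a neighbor of smallest load. Ties among the neighbors of smallest load are broken by the tie-breaking rule: either uniformly at random, or, when a fixed permutation (ordering) $\xi_v$ of the neighbors of $v$ is given for each $v$, by using at $v$ the order $\xi_v$. The search stops at the first vertex none of whose neighbors has a smaller load; the ball is placed there and the load of that vertex increases by $1$. $X_v^{(i)}$ is the load of $v$ right after ball $i$ is placed, and $X_{\max}^{(n)}=\max_{v\in V}X_v^{(n)}$. Here $\mathrm{e}$ is the base of the natural logarithm, and $d$ may depend on $n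$.
   Formalization: In (ii) it is additionally assumed that n·d is even: for n and d both odd (e.g. n = 4001, d = 3) no d-regular graph on n vertices exists, so the claim as written fails there; all other n, d in the stated range are covered. *)

theory Defs
  imports "HOL-Probability.Probability" "Graph_Theory.Graph_Theory"
begin

definition nbrs :: "'a pair_pre_digraph \<Rightarrow> 'a \<Rightarrow> 'a set" where
  "nbrs G v = {w. (v, w) \<in> parcs G}"

text \<open>In a symmetric loop-free digraph the out-degree is the number of neighbours.\<close>

definition max_degree :: "'a pair_pre_digraph \<Rightarrow> nat" where
  "max_degree G = Max (out_degree (with_proj G) ` pverts G)"

definition regular :: "'a pair_pre_digraph \<Rightarrow> nat \<Rightarrow> bool" where
  "regular G d \<longleftrightarrow> (\<forall>v\<in>pverts G. out_degree (with_proj G) v = d)"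

definition min_nbrs :: "'a pair_pre_digraph \<Rightarrow> ('a \<Rightarrow> nat) \<Rightarrow> 'a \<Rightarrow> 'a set" where
  "min_nbrs G X v = {w \<in> nbrs G v. \<forall>u\<in>nbrs G v. X w \<le> X u}"

text \<open>A permutation of the neighbours of \<open>v\<close> is given as the list \<open>\<xi> v\<close> enumerating
  them, most preferred neighbour first.\<close>

datatype 'a tie_rule = Random_Ties | Fixed_Ties "'a \<Rightarrow> 'a list"

fun valid_tie_rule :: "'a pair_pre_digraph \<Rightarrow> 'a tie_rule \<Rightarrow> bool" where
  "valid_tie_rule G Random_Ties \<longleftrightarrow> True"
| "valid_tie_rule G (Fixed_Ties \<xi>) \<longleftrightarrow>
     (\<forall>v\<in>pverts G. distinct (\<xi> v) \<and> set (\<xi> v) = nbrs G v)"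

fun break_tie :: "'a tie_rule \<Rightarrow> 'a \<Rightarrow> 'a set \<Rightarrow> 'a pmf" where
  "break_tie Random_Ties v S = pmf_of_set S"
| "break_tie (Fixed_Ties \<xi>) v S = return_pmf (hd (filter (\<lambda>w. w \<in> S) (\<xi> v)))"

definition max_load :: "'a pair_pre_digraph \<Rightarrow> ('a \<Rightarrow> nat) \<Rightarrow> nat" where
  "max_load G X = Max (X ` pverts G)"

locale local_search = pair_graph G for G :: "'a pair_pre_digraph" +
  fixes t :: "'a tie_rule"
  assumes valid: "valid_tie_rule G t"
begin

lemma finite_nbrs: "finite (nbrs G v)"
proof -
  have "nbrs G v = snd ` {e \<in> parcs G. fst e = v}"
    by (force simp: nbrs_def)
  thus ?thesis using pair_finite_arcs by simp
qed

lemma set_pmf_break_tie: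
  assumes "nbrs G v \<noteq> {}"
  shows "set_pmf (break_tie t v (min_nbrs G X v)) \<subseteq> min_nbrs G X v"
proof -
  obtain w where w: "w \<in> min_nbrs G X v"
    using ex_is_arg_min_if_finite[OF finite_nbrs assms, of X]
    by (force simp: min_nbrs_def is_arg_min_linorder)
  have fin: "finite (min_nbrs G X v)"
    by (rule finite_subset[OF _ finite_nbrs[of v]]) (auto simp: min_nbrs_def)
  show ?thesis
  proof (cases t)
    case Random_Ties
    moreover have "set_pmf (pmf_of_set (min_nbrs G X v)) = min_nbrs G X v"
      using w fin by (intro set_pmf_of_set) auto
    ultimately show ?thesis by simp
  next
    case (Fixed_Ties \<xi>)
    have "v \<in> pverts G"
      using assms in_arcsD1 by (auto simp: nbrs_def)
    hence "w \<in> set (filter (\<lambda>w. w \<in> min_nbrs G X v) (\<xi> v))"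
      using valid Fixed_Ties w by (auto simp: min_nbrs_def)
    hence "filter (\<lambda>w. w \<in> min_nbrs G X v) (\<xi> v) \<noteq> []"
      by (metis empty_iff list.set(1))
    hence "hd (filter (\<lambda>w. w \<in> min_nbrs G X v) (\<xi> v)) \<in> min_nbrs G X v"
      using hd_in_set by fastforce
    thus ?thesis by (simp add: Fixed_Ties)
  qed
qed

text \<open>Final vertex of a ball that is currently at \<open>v\<close> when the loads are \<open>X\<close>.\<close>

function search :: "('a \<Rightarrow> nat) \<Rightarrow> 'a \<Rightarrow> 'a pmf" where
  "search X v =
     (if \<exists>w\<in>nbrs G v. X w < X v
      then bind_pmf (break_tie t v (min_nbrs G X v)) (search X)
      else return_pmf v)"
  by pat_completeness auto
termination
proof (relation "Wellfounded.measure (\<lambda>(X, v). X v)")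
  fix X :: "'a \<Rightarrow> nat" and v w
  assume ex: "\<exists>u\<in>nbrs G v. X u < X v"
    and w: "w \<in> set_pmf (break_tie t v (min_nbrs G X v))"
  have "w \<in> min_nbrs G X v"
    using set_pmf_break_tie[of v X] ex w by blast
  thus "((X, w), (X, v)) \<in> Wellfounded.measure (\<lambda>(X, v). X v)"
    using ex by (fastforce simp: min_nbrs_def)
qed simp

declare search.simps [simp del]

text \<open>Joint law of the loads \<open>(X\<^sub>v)\<^sub>v\<close> right after ball \<open>i\<close> is placed. Each ball
  draws its birthplace (and its random tie-breaks) independently of the past.\<close>

primrec loads :: "nat \<Rightarrow> ('a \<Rightarrow> nat) pmf" where
  "loads 0 = return_pmf (\<lambda>_. 0)"
| "loads (Suc i) =
     bind_pmf (loads i) (\<lambda>X.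
     bind_pmf (pmf_of_set (pverts G)) (\<lambda>u.
     bind_pmf (search X u) (\<lambda>v.
     return_pmf (X(v := X v + 1)))))"

end

end

theory Submission
  imports Defs "HOL-Real_Asymp.Real_Asymp"
begin

text \<open>If all loads stay at most \<open>K\<close>, every ball moves at most \<open>K\<close> steps, whatever the tie-breaking
  rule. So if \<open>S\<close> is a set of vertices and \<open>T\<close> its \<open>K\<close>-neighbourhood, all balls born in \<open>S\<close> end up
  in \<open>T\<close>, and more than \<open>K * card T\<close> births in \<open>S\<close> force a load above \<open>K\<close>. By the second moment
  method, among many disjoint sets \<open>S\<close> of equal size one is likely to receive that many births.
  For (i) the sets \<open>S\<close> are the single vertices. For (ii) the graph is a circulant graph, which
  grows as slowly as its degree permits, and the sets \<open>S\<close> are arcs of about \<open>K * d\<close>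
  consecutive vertices.\<close>

section \<open>Numbers of births\<close>

text \<open>Both probabilities are read off the joint law of \<open>x\<close> and \<open>y\<close>,
  under which the first event is almost surely contained in the second. This transfers events on
  births to events on loads, whatever the tie-breaks.\<close>

lemma measure_bind_pmf_ge:
  assumes "\<And>x y. x \<in> set_pmf p \<Longrightarrow> x \<in> A \<Longrightarrow> y \<in> set_pmf (f x) \<Longrightarrow> y \<in> B"
  shows "measure_pmf.prob p A \<le> measure_pmf.prob (bind_pmf p f) B"
proof -
  define q where "q = bind_pmf p (\<lambda>x. map_pmf (Pair x) (f x))"
  have p: "p = map_pmf fst q"
    by (simp add: q_def map_bind_pmf pmf.map_comp o_def bind_return_pmf')
  have f: "bind_pmf p f = map_pmf snd q"
    by (simp add: q_def map_bind_pmf pmf.map_comp o_def pmf.map_ident)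
  have "measure_pmf.prob p A = measure_pmf.prob q (fst -` A)"
    by (subst p) simp
  also have "\<dots> \<le> measure_pmf.prob q (snd -` B)"
    by (rule measure_pmf.finite_measure_mono_AE)
      (use assms in \<open>auto simp: AE_measure_pmf_iff q_def\<close>)
  also have "\<dots> = measure_pmf.prob (bind_pmf p f) B"
    by (subst f) simp
  finally show ?thesis .
qed

text \<open>Chebyshev's inequality for the number \<open>X\<close> of events that occur: its mean is
  \<open>N * p\<close>, its variance is at most \<open>N * p\<close> because distinct events are not
  positively correlated, and \<open>X = 0\<close> is a deviation of \<open>N * p\<close>.\<close>

lemma prob_UN_ge_second_moment:
  fixes M :: "'b pmf" and Z :: "'i \<Rightarrow> 'b set" and p :: real
  assumes "finite I" "I \<noteq> {}" "p > 0"
    and Z: "\<And>i. i \<in> I \<Longrightarrow> measure_pmf.prob M (Z i) = p"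
    and ZZ: "\<And>i j. i \<in> I \<Longrightarrow> j \<in> I \<Longrightarrow> i \<noteq> j \<Longrightarrow> measure_pmf.prob M (Z i \<inter> Z j) \<le> p\<^sup>2"
  shows "measure_pmf.prob M (\<Union>i\<in>I. Z i) \<ge> 1 - 1 / (card I * p)"
proof -
  define N where "N = real (card I)"
  define X where "X = (\<lambda>\<omega>. \<Sum>i\<in>I. indicator (Z i) \<omega> :: real)"
  have N: "N > 0" using assms by (simp add: N_def card_gt_0_iff)
  have int: "integrable (measure_pmf M) (indicator A :: _ \<Rightarrow> real)" for A :: "'b set"
    by (simp add: measure_pmf.emeasure_eq_measure)
  have EX: "measure_pmf.expectation M X = N * p"
    unfolding X_def using int by (subst Bochner_Integration.integral_sum) (auto simp: Z N_def)
  have XX: "X \<omega> * X \<omega> = (\<Sum>i\<in>I. \<Sum>j\<in>I. indicator (Z i \<inter> Z j) \<omega>)" for \<omega>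
    by (simp add: X_def sum_product indicator_inter_arith)
  have intX: "integrable (measure_pmf M) X"
    unfolding X_def by (intro Bochner_Integration.integrable_sum int)
  have intXX: "integrable (measure_pmf M) (\<lambda>\<omega>. X \<omega> * X \<omega>)"
    unfolding XX by (intro Bochner_Integration.integrable_sum int)
  have "measure_pmf.expectation M (\<lambda>\<omega>. X \<omega> * X \<omega>)
      = (\<Sum>i\<in>I. \<Sum>j\<in>I. measure_pmf.prob M (Z i \<inter> Z j))"
    unfolding XX using int by (simp add: Bochner_Integration.integral_sum)
  \<comment> \<open>The diagonal terms equal \<open>p\<close>; allowing them
    \<open>p + p\<^sup>2\<close> lets the bound \<open>p\<^sup>2\<close> be summed over all
    pairs.\<close>
  also have "\<dots> \<le> (\<Sum>i\<in>I. \<Sum>j\<in>I. (if j = i then p else 0) + p\<^sup>2)"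
    by (intro sum_mono) (use Z ZZ in \<open>auto intro: add_increasing2\<close>)
  also have "\<dots> = N * p + N\<^sup>2 * p\<^sup>2"
    using assms(1) by (simp add: sum.distrib N_def power2_eq_square distrib_left)
  finally have EXX: "measure_pmf.expectation M (\<lambda>\<omega>. X \<omega> * X \<omega>) \<le> N * p + N\<^sup>2 * p\<^sup>2" .
  let ?B = "- (\<Union>i\<in>I. Z i)"
  have "(N * p)\<^sup>2 * measure_pmf.prob M ?B
      = measure_pmf.expectation M (\<lambda>\<omega>. (N * p)\<^sup>2 * indicator ?B \<omega>)"
    by simp
  \<comment> \<open>On \<open>?B\<close> the count \<open>X\<close> vanishes, so the integrand is at
    most the square of \<open>X - N * p\<close>, written in expanded form to use the moments
    above.\<close>
  also have "\<dots> \<le> measure_pmf.expectation M (\<lambda>\<omega>. X \<omega> * X \<omega> - 2 * (N * p) * X \<omega> + (N * p)\<^sup>2)"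
  proof (rule integral_mono)
    fix \<omega>
    have "X \<omega> = 0" if "\<omega> \<in> ?B" using that by (auto simp: X_def)
    moreover have "0 \<le> (X \<omega> - N * p)\<^sup>2" by simp
    hence "0 \<le> X \<omega> * X \<omega> - 2 * (N * p) * X \<omega> + (N * p)\<^sup>2"
      by (simp add: power2_eq_square algebra_simps)
    ultimately show "(N * p)\<^sup>2 * indicator ?B \<omega> \<le> X \<omega> * X \<omega> - 2 * (N * p) * X \<omega> + (N * p)\<^sup>2"
      by (cases "\<omega> \<in> ?B") (auto simp del: UN_iff Compl_iff)
  qed (use int intX intXX in auto)
  also have "\<dots> = measure_pmf.expectation M (\<lambda>\<omega>. X \<omega> * X \<omega>) - 2 * (N * p) * (N * p) + (N * p)\<^sup>2"
    using int intX intXX by (simp add: EX)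
  also have "\<dots> \<le> N * p"
    using EXX by (simp add: power2_eq_square algebra_simps)
  finally have "measure_pmf.prob M ?B \<le> 1 / (N * p)"
    using N \<open>p > 0\<close> by (simp add: power2_eq_square field_simps)
  moreover have "measure_pmf.prob M (\<Union>i\<in>I. Z i) = 1 - measure_pmf.prob M ?B"
    using measure_pmf.prob_compl[of "\<Union>i\<in>I. Z i" M] by (simp add: Compl_eq_Diff_UNIV)
  ultimately show ?thesis by (simp add: N_def)
qed

section \<open>Independent uniform samples hitting disjoint sets\<close>

lemma prob_pair_pmf_Times:
  "measure_pmf.prob (pair_pmf p q) (A \<times> B) = measure_pmf.prob p A * measure_pmf.prob q B"
proof -
  \<comment> \<open>Intersecting with the supports makes both factors countable, as
    \<open>measure_pmf_prob_product\<close> requires.\<close>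
  have "measure_pmf.prob (pair_pmf p q) (A \<times> B)
      = measure_pmf.prob (pair_pmf p q) ((A \<inter> set_pmf p) \<times> (B \<inter> set_pmf q))"
    by (subst measure_Int_set_pmf[symmetric]) (auto intro!: arg_cong[where f = "measure_pmf.prob _"])
  also have "\<dots> = measure_pmf.prob p (A \<inter> set_pmf p) * measure_pmf.prob q (B \<inter> set_pmf q)"
    by (intro measure_pmf_prob_product) auto
  finally show ?thesis by (simp add: measure_Int_set_pmf)
qed

lemma prob_replicate_pmf_subset:
  "measure_pmf.prob (replicate_pmf n p) {xs. set xs \<subseteq> A} = measure_pmf.prob p A ^ n"
proof (induction n)
  case (Suc n)
  have "replicate_pmf (Suc n) p = map_pmf (\<lambda>(x, xs). x # xs) (pair_pmf p (replicate_pmf n p))"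
    by (simp add: pair_pmf_def map_bind_pmf)
  hence "measure_pmf.prob (replicate_pmf (Suc n) p) {xs. set xs \<subseteq> A}
     = measure_pmf.prob (pair_pmf p (replicate_pmf n p)) ((\<lambda>(x, xs). x # xs) -` {xs. set xs \<subseteq> A})"
    by simp
  also have "(\<lambda>(x, xs). x # xs) -` {xs. set xs \<subseteq> A} = A \<times> {xs. set xs \<subseteq> A}"
    by auto
  also have "measure_pmf.prob (pair_pmf p (replicate_pmf n p)) \<dots>
      = measure_pmf.prob p A * measure_pmf.prob (replicate_pmf n p) {xs. set xs \<subseteq> A}"
    by (rule prob_pair_pmf_Times)
  finally show ?case using Suc by simp
qed auto

lemma concat_replicate_pmf:
  "map_pmf concat (replicate_pmf m (replicate_pmf b p)) = replicate_pmf (m * b) p"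
proof (induction m)
  case (Suc m)
  show ?case
    by (simp only: replicate_pmf.simps mult_Suc replicate_pmf_distrib flip: Suc)
      (simp add: map_bind_pmf bind_map_pmf)
qed auto

definition hits :: "'a set \<Rightarrow> 'a list set" where
  "hits A = {xs. set xs \<inter> A \<noteq> {}}"

lemma prob_hits:
  assumes "finite V" "V \<noteq> {}" "A \<subseteq> V"
  shows "measure_pmf.prob (replicate_pmf b (pmf_of_set V)) (hits A) = 1 - (1 - card A / card V) ^ b"
proof -
  have "measure_pmf.prob (pmf_of_set V) (- A) = 1 - card A / card V"
    by (subst measure_pmf.prob_compl[of A "pmf_of_set V", simplified, folded Compl_eq_Diff_UNIV])
      (use assms in \<open>auto simp: measure_pmf_of_set Int_absorb1\<close>)
  moreover have "hits A = - {xs. set xs \<subseteq> - A}" by (auto simp: hits_def)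
  ultimately show ?thesis
    by (simp add: Compl_eq_Diff_UNIV measure_pmf.prob_compl[simplified]
      prob_replicate_pmf_subset[of b "pmf_of_set V" "-A", unfolded Compl_eq_Diff_UNIV])
qed

text \<open>Inclusion-exclusion reduces the claim to the event that both sets are missed. For
  densities \<alpha> and \<beta> of the two disjoint sets, this follows from 1 - \<alpha> - \<beta>
  \<le> (1 - \<alpha>)(1 - \<beta>).\<close>

lemma prob_hits_Int:
  assumes "finite V" "V \<noteq> {}" "A \<subseteq> V" "B \<subseteq> V" "A \<inter> B = {}"
  shows "measure_pmf.prob (replicate_pmf b (pmf_of_set V)) (hits A \<inter> hits B)
     \<le> (1 - (1 - card A / card V) ^ b) * (1 - (1 - card B / card V) ^ b)"
proof -
  let ?P = "measure_pmf.prob (replicate_pmf b (pmf_of_set V))"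
  let ?a = "real (card A) / card V" and ?b = "real (card B) / card V"
  have fin: "finite A" "finite B" using assms by (auto intro: finite_subset)
  have "hits A \<union> hits B = hits (A \<union> B)" by (auto simp: hits_def)
  hence eq: "?P (hits A \<inter> hits B) = ?P (hits A) + ?P (hits B) - ?P (hits (A \<union> B))"
    using measure_pmf.finite_measure_Union'[of "hits A" "replicate_pmf b (pmf_of_set V)" "hits B"]
      measure_pmf.finite_measure_Diff'[of "hits B" "replicate_pmf b (pmf_of_set V)" "hits A"]
    by (simp add: Int_commute)
  have V: "card V > 0" using assms by (simp add: card_gt_0_iff)
  have c: "card (A \<union> B) = card A + card B" using fin assms by (simp add: card_Un_disjoint)
  \<comment> \<open>The densities add up to at most 1, so the base of the smaller power is
    nonnegative.\<close>
  have "card (A \<union> B) \<le> card V" using assms by (intro card_mono) auto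
  hence "?a + ?b \<le> 1" using V by (simp add: c field_simps)
  hence "(1 - (?a + ?b)) ^ b \<le> ((1 - ?a) * (1 - ?b)) ^ b"
    by (intro power_mono) (auto simp: algebra_simps)
  moreover have "?P (hits (A \<union> B)) = 1 - (1 - (?a + ?b)) ^ b"
    using assms by (subst prob_hits) (auto simp: c add_divide_distrib)
  moreover have "?P (hits A) = 1 - (1 - ?a) ^ b" "?P (hits B) = 1 - (1 - ?b) ^ b"
    using assms by (simp_all add: prob_hits)
  ultimately show ?thesis
    unfolding eq power_mult_distrib by (simp add: algebra_simps)
qed

lemma length_filter_concat_ge:
  assumes "\<forall>xs\<in>set xss. xs \<in> hits A"
  shows "length xss \<le> length (filter (\<lambda>x. x \<in> A) (concat xss))"
  using assms
proof (induction xss)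
  case (Cons xs xss)
  hence "filter (\<lambda>x. x \<in> A) xs \<noteq> []" by (auto simp: hits_def filter_empty_conv)
  hence "length (filter (\<lambda>x. x \<in> A) xs) \<ge> 1" by (simp add: Suc_leI)
  thus ?case using Cons by simp
qed simp

text \<open>With \<open>x = b * q\<close>, the power is at most exp(-x), then at most 1/(1 + x), and
  for 0 \<le> x \<le> 1 this is at most 1 - x/2.\<close>

lemma one_minus_power_ge:
  fixes q :: real
  assumes "0 \<le> q" "q \<le> 1" "b * q \<le> 1"
  shows "1 - (1 - q) ^ b \<ge> b * q / 2"
proof -
  let ?x = "b * q"
  have x: "0 \<le> ?x" using assms by simp
  have "(1 - q) ^ b \<le> exp (- q) ^ b"
    using assms exp_ge_add_one_self[of "-q"] by (intro power_mono) auto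
  also have "\<dots> = exp (- ?x)" by (simp flip: exp_of_nat_mult)
  also have "\<dots> \<le> inverse (1 + ?x)"
    using exp_ge_add_one_self[of ?x] x by (simp add: exp_minus le_imp_inverse_le)
  also have "\<dots> \<le> 1 - ?x / 2"
  proof -
    have "?x * ?x \<le> ?x * 1" using x assms by (intro mult_left_mono)
    hence "1 \<le> (1 - ?x / 2) * (1 + ?x)" by (simp add: algebra_simps)
    thus ?thesis using x by (simp add: inverse_eq_divide divide_le_eq)
  qed
  finally show ?thesis by simp
qed

text \<open>Splitting the sequence into \<open>m\<close> blocks, it suffices that every block hits \<open>S i\<close>; for
  disjoint sets these events are negatively correlated, so the second moment method applies.\<close>

lemma prob_some_set_hit_often:
  fixes S :: "'i \<Rightarrow> 'a set"
  assumes V: "finite V" "card V = n" and I: "finite I" "I \<noteq> {}"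
    and S: "\<And>i. i \<in> I \<Longrightarrow> S i \<subseteq> V" "\<And>i. i \<in> I \<Longrightarrow> card (S i) = s"
    and disj: "\<And>i j. i \<in> I \<Longrightarrow> j \<in> I \<Longrightarrow> i \<noteq> j \<Longrightarrow> S i \<inter> S j = {}"
    and s: "1 \<le> s" "s \<le> m" "m \<le> n"
  shows "measure_pmf.prob (replicate_pmf n (pmf_of_set V))
      {us. \<exists>i\<in>I. m \<le> length (filter (\<lambda>u. u \<in> S i) us)}
    \<ge> 1 - 1 / (card I * (s / (4 * m)) ^ m)"
proof -
  define b where "b = n div m"
  define U where "U = pmf_of_set V"
  define R where "R = replicate_pmf b U"
  define M where "M = replicate_pmf m R"
  define q where "q = real s / n"
  define p where "p = (1 - (1 - q) ^ b) ^ m"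
  define Z where "Z i = {xss. set xss \<subseteq> hits (S i)}" for i
  have mn: "0 < m" "0 < n" using s by auto
  have "V \<noteq> {}" using V mn by auto
  have n: "n = m * b + n mod m" by (simp add: b_def)
  have bm: "b * m \<le> n" by (simp add: b_def)
  \<comment> \<open>Rounding in \<open>n div m\<close> loses less than a factor 2, since the
    remainder is below one block count \<open>m \<le> m * b\<close>.\<close>
  have "n < 2 * (b * m)"
  proof -
    have "n mod m < m" "1 \<le> b" using mn s by (auto simp: b_def div_greater_zero_iff Suc_le_eq)
    moreover from this have "m * 1 \<le> m * b" by (intro mult_left_mono) auto
    ultimately show ?thesis using n by (simp only: mult.commute[of b] mult_1_right)
  qed
  hence bm': "real n < 2 * (real b * real m)" by (metis of_nat_less_iff of_nat_mult of_nat_numeral)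
  have q: "0 < q" "q \<le> 1" "b * q \<le> 1"
  proof -
    \<comment> \<open>A block contains at most one birth in \<open>S i\<close> on average because
      \<open>s \<le> m\<close>; this is the range covered by
      \<open>one_minus_power_ge\<close>.\<close>
    have "b * s \<le> b * m" using s by simp
    hence "b * s \<le> n" using bm by (rule le_trans)
    hence "real b * real s \<le> real n" by (metis of_nat_le_iff of_nat_mult)
    thus "0 < q" "q \<le> 1" "b * q \<le> 1" using s mn by (auto simp: q_def)
  qed
  \<comment> \<open>The 4 in \<open>s / (4 * m)\<close> combines the factor 2 from rounding
    \<open>b\<close> with the factor 2 from \<open>one_minus_power_ge\<close>.\<close>
  have "real s * n \<le> real s * (2 * (real b * real m))"
    using bm' by (intro mult_left_mono) auto
  hence "real s / (4 * m) \<le> b * q / 2"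
    using mn by (simp add: q_def divide_simps mult_ac)
  also have "\<dots> \<le> 1 - (1 - q) ^ b" using q by (intro one_minus_power_ge) auto
  finally have hit: "s / (4 * m) \<le> 1 - (1 - q) ^ b" .
  have p: "(s / (4 * m)) ^ m \<le> p"
    unfolding p_def by (intro power_mono hit) auto
  have pos: "0 < (real s / (4 * m)) ^ m" using s mn by simp
  have PZ: "measure_pmf.prob M (Z i) = p" if "i \<in> I" for i
    unfolding M_def Z_def prob_replicate_pmf_subset R_def U_def p_def q_def
    using that V S \<open>V \<noteq> {}\<close> by (subst prob_hits) auto
  have PZZ: "measure_pmf.prob M (Z i \<inter> Z j) \<le> p\<^sup>2" if "i \<in> I" "j \<in> I" "i \<noteq> j" for i j
  proof -
    \<comment> \<open>The intersection is again an event required of every block separately, so the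
      bound for one block is raised to the power \<open>m\<close>.\<close>
    have "Z i \<inter> Z j = {xss. set xss \<subseteq> hits (S i) \<inter> hits (S j)}" by (auto simp: Z_def)
    hence "measure_pmf.prob M (Z i \<inter> Z j) = measure_pmf.prob R (hits (S i) \<inter> hits (S j)) ^ m"
      by (simp only: M_def prob_replicate_pmf_subset)
    also have "\<dots> \<le> ((1 - (1 - q) ^ b) * (1 - (1 - q) ^ b)) ^ m"
      using prob_hits_Int[of V "S i" "S j" b] that V S \<open>V \<noteq> {}\<close> disj
      by (intro power_mono) (auto simp: R_def U_def q_def)
    also have "\<dots> = p\<^sup>2" by (simp add: p_def power2_eq_square power_mult_distrib)
    finally show ?thesis .
  qed
  have card: "card I > 0" using I by (simp add: card_gt_0_iff)
  have "1 - 1 / (card I * (s / (4 * m)) ^ m) \<le> 1 - 1 / (card I * p)"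
    using p pos card by (intro diff_left_mono frac_le mult_left_mono) auto
  also have "\<dots> \<le> measure_pmf.prob M (\<Union>i\<in>I. Z i)"
    using order.strict_trans2[OF pos p] by (rule prob_UN_ge_second_moment[OF I _ PZ PZZ])
  \<comment> \<open>The \<open>n mod m\<close> draws outside the blocks are appended; they can only
    add births.\<close>
  also have "\<dots> \<le> measure_pmf.prob (bind_pmf M (\<lambda>xss. map_pmf ((@) (concat xss)) (replicate_pmf (n mod m) U)))
      {us. \<exists>i\<in>I. m \<le> length (filter (\<lambda>u. u \<in> S i) us)}"
  proof (rule measure_bind_pmf_ge)
    fix xss us
    assume M: "xss \<in> set_pmf M" and "xss \<in> (\<Union>i\<in>I. Z i)"
      and us: "us \<in> set_pmf (map_pmf ((@) (concat xss)) (replicate_pmf (n mod m) U))"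
    then obtain i where i: "i \<in> I" "xss \<in> Z i" by blast
    have "length xss = m" using M by (auto simp: M_def set_replicate_pmf)
    hence "m \<le> length (filter (\<lambda>u. u \<in> S i) (concat xss))"
      using length_filter_concat_ge[of xss "S i"] i by (auto simp: Z_def)
    thus "us \<in> {us. \<exists>i\<in>I. m \<le> length (filter (\<lambda>u. u \<in> S i) us)}"
      using us i by (auto intro!: bexI[of _ i])
  qed
  also have "bind_pmf M (\<lambda>xss. map_pmf ((@) (concat xss)) (replicate_pmf (n mod m) U))
      = replicate_pmf (m * b + n mod m) U"
    by (simp only: replicate_pmf_distrib flip: concat_replicate_pmf)
      (simp add: M_def R_def map_pmf_def bind_assoc_pmf bind_return_pmf)
  finally show ?thesis using n by (simp add: U_def)
qed

section \<open>From births to loads\<close>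

context local_search
begin

definition place :: "('a \<Rightarrow> nat) \<Rightarrow> 'a \<Rightarrow> ('a \<Rightarrow> nat) pmf" where
  "place X u = map_pmf (\<lambda>v. X(v := X v + 1)) (search X u)"

text \<open>The process with prescribed birthplaces: only the tie-breaks remain random. The initial
  loads are a parameter so that induction on the birthplaces goes through.\<close>

primrec run :: "('a \<Rightarrow> nat) \<Rightarrow> 'a list \<Rightarrow> ('a \<Rightarrow> nat) pmf" where
  "run X [] = return_pmf X"
| "run X (u # us) = bind_pmf (place X u) (\<lambda>Y. run Y us)"

lemma run_snoc: "run X (us @ [u]) = bind_pmf (run X us) (\<lambda>Y. place Y u)"
  by (induction us arbitrary: X) (simp_all add: bind_return_pmf bind_return_pmf' bind_assoc_pmf)

text \<open>Birthplaces are independent of the loads, so all of them can be drawn before the first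
  ball is placed.\<close>

lemma loads_eq_run:
  "loads n = bind_pmf (replicate_pmf n (pmf_of_set (pverts G))) (run (\<lambda>_. 0))"
proof (induction n)
  case (Suc n)
  have "replicate_pmf (Suc n) p = bind_pmf (replicate_pmf n p) (\<lambda>us. map_pmf (\<lambda>u. us @ [u]) p)"
    for p :: "'a pmf"
    using replicate_pmf_distrib[of n 1 p]
    by (simp add: bind_assoc_pmf bind_return_pmf map_pmf_def)
  hence "bind_pmf (replicate_pmf (Suc n) U) (run (\<lambda>_. 0))
      = bind_pmf (replicate_pmf n U) (\<lambda>us. bind_pmf U (\<lambda>u. run (\<lambda>_. 0) (us @ [u])))"
    for U :: "'a pmf"
    by (simp only: bind_assoc_pmf bind_map_pmf)
  also have "bind_pmf (replicate_pmf n U) (\<lambda>us. bind_pmf U (\<lambda>u. run (\<lambda>_. 0) (us @ [u])))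
      = bind_pmf (replicate_pmf n U) (\<lambda>us. bind_pmf (run (\<lambda>_. 0) us) (\<lambda>X. bind_pmf U (place X)))"
    for U :: "'a pmf"
    \<comment> \<open>The draw of the last birthplace commutes with the run of the earlier
      balls.\<close>
    by (simp only: run_snoc) (subst bind_commute_pmf, rule refl)
  finally show ?case
    by (simp add: Suc bind_assoc_pmf place_def[abs_def] map_pmf_def del: replicate_pmf.simps)
qed (simp add: bind_return_pmf)

lemma run_mono: "Y \<in> set_pmf (run X us) \<Longrightarrow> X v \<le> Y v"
proof (induction us arbitrary: X)
  case (Cons u us)
  then obtain W where W: "W \<in> set_pmf (place X u)" "Y \<in> set_pmf (run W us)" by auto
  have "X v \<le> W v" using W(1) by (auto simp: place_def)
  thus ?case using Cons.IH[OF W(2)] by simp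
qed simp

text \<open>The load strictly decreases along the walk, so a ball born at \<open>v\<close> makes at most \<open>X v\<close>
  steps.\<close>

lemma search_confined:
  assumes T: "\<And>r. T r \<subseteq> T (Suc r)" "\<And>r u. u \<in> T r \<Longrightarrow> nbrs G u \<subseteq> T (Suc r)"
  shows "v \<in> T r \<Longrightarrow> w \<in> set_pmf (search X v) \<Longrightarrow> w \<in> T (r + X v)"
proof (induction X v arbitrary: r rule: search.induct)
  case (1 X v)
  have mono: "T i \<subseteq> T j" if "i \<le> j" for i j using T(1) that by (rule lift_Suc_mono_le)
  show ?case
  proof (cases "\<exists>u\<in>nbrs G v. X u < X v")
    case True
    then obtain u where u: "u \<in> set_pmf (break_tie t v (min_nbrs G X v))"
      and w: "w \<in> set_pmf (search X u)"
      using "1.prems"(2) by (subst (asm) search.simps) auto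
    have um: "u \<in> min_nbrs G X v" using set_pmf_break_tie[of v X] True u by blast
    hence "X u < X v" using True by (fastforce simp: min_nbrs_def)
    moreover have "u \<in> T (Suc r)" using T(2) "1.prems"(1) um by (auto simp: min_nbrs_def)
    hence "w \<in> T (Suc r + X u)" using "1.IH"[OF True] u w by blast
    moreover have "T (Suc r + X u) \<subseteq> T (r + X v)" by (rule mono) (use \<open>X u < X v\<close> in simp)
    ultimately show ?thesis by blast
  next
    case False
    hence "w = v" using "1.prems"(2) by (subst (asm) search.simps) auto
    moreover have "T r \<subseteq> T (r + X v)" by (rule mono) simp
    ultimately show ?thesis using "1.prems"(1) by blast
  qed
qed

text \<open>A ball born in \<open>S\<close> makes at most \<open>K\<close> steps, so it lands in
  \<open>T K\<close> and raises the total load there; other balls never lower it. The family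
  \<open>T\<close> is abstract in order to cover both metric balls and arcs.\<close>

lemma births_le_loads:
  assumes T: "\<And>r. T r \<subseteq> T (Suc r)" "\<And>r u. u \<in> T r \<Longrightarrow> nbrs G u \<subseteq> T (Suc r)"
    and S: "S \<subseteq> T 0" and fin: "finite (T K)"
  shows "Y \<in> set_pmf (run X us) \<Longrightarrow> set us \<subseteq> pverts G \<Longrightarrow> (\<And>v. v \<in> pverts G \<Longrightarrow> Y v \<le> K) \<Longrightarrow>
    sum X (T K) + length (filter (\<lambda>u. u \<in> S) us) \<le> sum Y (T K)"
proof (induction us arbitrary: X)
  case (Cons u us)
  have mono: "T i \<subseteq> T j" if "i \<le> j" for i j using T(1) that by (rule lift_Suc_mono_le)
  obtain W where W: "W \<in> set_pmf (place X u)" "Y \<in> set_pmf (run W us)"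
    using Cons.prems(1) by auto
  then obtain w where w: "w \<in> set_pmf (search X u)" "W = X(w := X w + 1)"
    by (auto simp: place_def)
  \<comment> \<open>The bound \<open>K\<close> is assumed for the final loads only; it passes to the
    current ones because loads never decrease.\<close>
  have "X u \<le> Y u" using run_mono[of Y X "u # us" u] Cons.prems(1) by blast
  also have "\<dots> \<le> K" using Cons.prems(2) by (intro Cons.prems(3)) simp
  finally have Xu: "X u \<le> K" .
  have "sum X (T K) + (if u \<in> S then 1 else 0) \<le> sum W (T K)"
  proof (cases "u \<in> S")
    case True
    hence "u \<in> T 0" using S by blast
    from search_confined[of T, OF T this w(1)] have "w \<in> T (0 + X u)" .
    hence "w \<in> T K" using mono[OF Xu] by (simp add: subset_iff)
    moreover have "sum W (T K - {w}) = sum X (T K - {w})"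
      by (rule sum.cong) (auto simp: w(2))
    ultimately show ?thesis
      using sum.remove[OF fin, of w X] sum.remove[OF fin, of w W] by (simp add: w(2))
  next
    case False
    have "sum X (T K) \<le> sum W (T K)" by (rule sum_mono) (simp add: w(2))
    thus ?thesis using False by simp
  qed
  moreover have "sum W (T K) + length (filter (\<lambda>u. u \<in> S) us) \<le> sum Y (T K)"
    using W(2) Cons.prems(2,3) by (intro Cons.IH) simp_all
  ultimately show ?case by (simp split: if_splits)
qed simp

text \<open>Pigeonhole: if all loads were at most \<open>K\<close>, then \<open>T K\<close> would
  hold at most \<open>K * card (T K)\<close> balls, fewer than are forced into it.\<close>

lemma max_load_gt:
  assumes T: "\<And>r. T r \<subseteq> T (Suc r)" "\<And>r u. u \<in> T r \<Longrightarrow> nbrs G u \<subseteq> T (Suc r)"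
    and S: "S \<subseteq> T 0" and V: "T K \<subseteq> pverts G"
    and m: "K * card (T K) < length (filter (\<lambda>u. u \<in> S) us)"
    and us: "set us \<subseteq> pverts G" and Y: "Y \<in> set_pmf (run (\<lambda>_. 0) us)"
  shows "K < max_load G Y"
proof (rule ccontr)
  assume "\<not> K < max_load G Y"
  hence le: "Y v \<le> K" if "v \<in> pverts G" for v
    using Max_ge[OF finite_imageI[OF pair_finite_verts] imageI[OF that], of Y]
    by (simp add: max_load_def)
  have "finite (T K)" using V pair_finite_verts finite_subset by blast
  from births_le_loads[OF T S this Y us le]
  have "length (filter (\<lambda>u. u \<in> S) us) \<le> sum Y (T K)" by simp
  also have "\<dots> \<le> card (T K) * K"
    using sum_bounded_above[of "T K" Y K] le V by auto
  finally show False using m by (simp add: mult.commute)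
qed

text \<open>The second moment bound yields an index \<open>i\<close> with at least \<open>m\<close>
  births in \<open>S i\<close>, and \<open>max_load_gt\<close> applies to every run from such
  birthplaces.\<close>

lemma prob_max_load_gt:
  fixes S :: "'i \<Rightarrow> 'a set" and T :: "'i \<Rightarrow> nat \<Rightarrow> 'a set"
  assumes n: "card (pverts G) = n" and I: "finite I" "I \<noteq> {}"
    and S: "\<And>i. i \<in> I \<Longrightarrow> S i \<subseteq> T i 0" "\<And>i. i \<in> I \<Longrightarrow> card (S i) = s"
    and disj: "\<And>i j. i \<in> I \<Longrightarrow> j \<in> I \<Longrightarrow> i \<noteq> j \<Longrightarrow> S i \<inter> S j = {}"
    and T: "\<And>i r. i \<in> I \<Longrightarrow> T i r \<subseteq> T i (Suc r)"
      "\<And>i r u. i \<in> I \<Longrightarrow> u \<in> T i r \<Longrightarrow> nbrs G u \<subseteq> T i (Suc r)"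
    and TV: "\<And>i. i \<in> I \<Longrightarrow> T i K \<subseteq> pverts G"
    and TK: "\<And>i. i \<in> I \<Longrightarrow> K * card (T i K) < m"
    and s: "1 \<le> s" "s \<le> m" "m \<le> n"
  shows "measure_pmf.prob (loads n) {X. K < max_load G X} \<ge> 1 - (4 * m / s) ^ m / card I"
proof -
  have ne: "pverts G \<noteq> {}" using n s by auto
  have "T i 0 \<subseteq> T i K" if "i \<in> I" for i
    using T(1)[OF that] by (rule lift_Suc_mono_le) simp
  hence SV: "S i \<subseteq> pverts G" if "i \<in> I" for i using S(1) TV that by blast
  have "1 - (4 * real m / s) ^ m / card I = 1 - 1 / (card I * (s / (4 * m)) ^ m)"
    by (simp add: power_divide)
  also have "\<dots> \<le> measure_pmf.prob (replicate_pmf n (pmf_of_set (pverts G)))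
      {us. \<exists>i\<in>I. m \<le> length (filter (\<lambda>u. u \<in> S i) us)}"
    unfolding of_nat_mult of_nat_numeral
    by (rule prob_some_set_hit_often) (use pair_finite_verts n I S SV disj s in auto)
  also have "\<dots> \<le> measure_pmf.prob (loads n) {X. K < max_load G X}"
    unfolding loads_eq_run
  proof (rule measure_bind_pmf_ge)
    fix us Y
    assume us: "us \<in> set_pmf (replicate_pmf n (pmf_of_set (pverts G)))"
      and "us \<in> {us. \<exists>i\<in>I. m \<le> length (filter (\<lambda>u. u \<in> S i) us)}"
      and Y: "Y \<in> set_pmf (run (\<lambda>_. 0) us)"
    then obtain i where i: "i \<in> I" "m \<le> length (filter (\<lambda>u. u \<in> S i) us)" by blast
    have "set us \<subseteq> pverts G"
      using us ne pair_finite_verts by (auto simp: set_replicate_pmf)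
    thus "Y \<in> {X. K < max_load G X}"
      using max_load_gt[of "T i" "S i" K us Y] i T S TV TK[OF i(1)] Y by auto
  qed
  finally show ?thesis .
qed

text \<open>The case \<open>K = 0\<close> with all vertices as \<open>S\<close> and
  \<open>T\<close>; it settles targets below 1.\<close>

lemma prob_max_load_pos:
  assumes "card (pverts G) = n" "1 \<le> n"
  shows "measure_pmf.prob (loads n) {X. 0 < max_load G X} = 1"
proof -
  have ne: "pverts G \<noteq> {}" using assms by auto
  have "1 = measure_pmf.prob (replicate_pmf n (pmf_of_set (pverts G))) UNIV" by simp
  also have "\<dots> \<le> measure_pmf.prob (loads n) {X. 0 < max_load G X}"
    unfolding loads_eq_run
  proof (rule measure_bind_pmf_ge)
    fix us Y
    assume us: "us \<in> set_pmf (replicate_pmf n (pmf_of_set (pverts G)))"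
      and Y: "Y \<in> set_pmf (run (\<lambda>_. 0) us)"
    have V: "set us \<subseteq> pverts G" and "length us = n"
      using us ne pair_finite_verts by (auto simp: set_replicate_pmf)
    hence "filter (\<lambda>u. u \<in> pverts G) us = us" "length us = n" by (auto intro: filter_True)
    thus "Y \<in> {X. 0 < max_load G X}"
      using max_load_gt[of "\<lambda>_. pverts G" "pverts G" 0 us Y] assms V Y in_arcsD2
      by (force simp: nbrs_def)
  qed
  finally show ?thesis by (simp add: antisym)
qed

end

section \<open>General graphs\<close>

text \<open>Closed balls of the graph metric, in the recursive form demanded of the family
  \<open>T\<close>.\<close>

primrec nbhd :: "'a pair_pre_digraph \<Rightarrow> 'a \<Rightarrow> nat \<Rightarrow> 'a set" where
  "nbhd G v 0 = {v}"
| "nbhd G v (Suc r) = nbhd G v r \<union> (\<Union>u\<in>nbhd G v r. nbrs G u)"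

context pair_graph
begin

lemma nbrs_subset: "nbrs G v \<subseteq> pverts G"
  using in_arcsD2 by (auto simp: nbrs_def)

lemma out_degree_eq_card_nbrs: "out_degree (with_proj G) v = card (nbrs G v)"
proof -
  have "out_arcs (with_proj G) v = Pair v ` nbrs G v"
    by (auto simp: out_arcs_def nbrs_def)
  thus ?thesis by (simp add: out_degree_def card_image inj_on_def)
qed

lemma card_nbrs_le: "v \<in> pverts G \<Longrightarrow> card (nbrs G v) \<le> max_degree G"
  unfolding max_degree_def out_degree_eq_card_nbrs
  using pair_finite_verts by (intro Max_ge) auto

lemma nbhd_subset: "v \<in> pverts G \<Longrightarrow> nbhd G v r \<subseteq> pverts G"
  by (induction r) (use nbrs_subset in auto)

text \<open>Each vertex of the old ball accounts for itself and at most \<open>max_degree G\<close>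
  neighbours, hence the factor \<open>max_degree G + 1\<close> per step.\<close>

lemma card_nbhd_le:
  assumes "v \<in> pverts G"
  shows "card (nbhd G v r) \<le> (max_degree G + 1) ^ r"
proof (induction r)
  case (Suc r)
  have fin: "finite (nbhd G v r)"
    using nbhd_subset[OF assms] pair_finite_verts by (rule finite_subset)
  have "card (nbhd G v (Suc r)) \<le> card (nbhd G v r) + card (\<Union>u\<in>nbhd G v r. nbrs G u)"
    by (simp add: card_Un_le)
  also have "card (\<Union>u\<in>nbhd G v r. nbrs G u) \<le> (\<Sum>u\<in>nbhd G v r. card (nbrs G u))"
    using fin by (rule card_UN_le)
  also have "\<dots> \<le> card (nbhd G v r) * max_degree G"
    using sum_bounded_above[of "nbhd G v r" "\<lambda>u. card (nbrs G u)" "max_degree G"]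
      card_nbrs_le nbhd_subset[OF assms, of r] by auto
  finally have "card (nbhd G v (Suc r)) \<le> card (nbhd G v r) * (max_degree G + 1)"
    by simp
  also have "\<dots> \<le> (max_degree G + 1) ^ r * (max_degree G + 1)"
    using Suc by (intro mult_right_mono) auto
  finally show ?case by (simp add: mult.commute)
qed simp

text \<open>Singletons give \<open>s = 1\<close> and as many disjoint sets as there are
  vertices.\<close>

lemma prob_max_load_gt_single_births:
  assumes t: "valid_tie_rule G t" and n: "card (pverts G) = n"
    and K: "K * (max_degree G + 1) ^ K < m" "m \<le> n"
  shows "measure_pmf.prob (local_search.loads G t n) {X. K < max_load G X} \<ge> 1 - (4 * real m) ^ m / n"
proof -
  interpret local_search G t by unfold_locales (rule t)
  have m: "1 \<le> m" using K by simp
  have "measure_pmf.prob (loads n) {X. K < max_load G X}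
      \<ge> 1 - (4 * real m / real 1) ^ m / card (pverts G)"
  proof (rule prob_max_load_gt[where S = "\<lambda>v. {v}" and T = "nbhd G"])
    fix v assume v: "v \<in> pverts G"
    have "K * card (nbhd G v K) \<le> K * (max_degree G + 1) ^ K"
      using card_nbhd_le[OF v] by (rule mult_left_mono) simp
    thus "K * card (nbhd G v K) < m" using K by linarith
  qed (use n m K pair_finite_verts nbhd_subset in auto)
  thus ?thesis by (simp add: n)
qed

end

section \<open>Choice of parameters for general graphs\<close>

text \<open>Taking \<open>m\<close> near the square root of ln n keeps (4m)^m at n^o(1), so the
  failure probability tends to 0. Taking \<open>K\<close> as the integer part of the target keeps
  balls of radius \<open>K\<close> so small that \<open>K\<close> times their size stays below
  \<open>m\<close>.\<close>

lemma max_load_ge_ln_ln: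
  "\<exists>c>0. \<exists>\<epsilon> :: nat \<Rightarrow> real. \<epsilon> \<longlonglongrightarrow> 0 \<and>
      (\<forall>n. \<forall>G :: 'a pair_pre_digraph.
         pair_graph G \<and> card (pverts G) = n \<longrightarrow>
         (\<forall>t. valid_tie_rule G t \<longrightarrow>
            measure_pmf.prob (local_search.loads G t n)
              {X. real (max_load G X) \<ge> c * (ln (ln (real n)) / ln (real (max_degree G)))}
            \<ge> 1 - \<epsilon> n))"
proof -
  \<comment> \<open>Since D + 1 \<le> D^2 for D \<ge> 2, a ball of radius \<open>K\<close> has at
    most exp(2 K ln D) \<le> L^(2c) vertices, and 2c = 1/8.\<close>
  define c :: real where "c = 1 / 16"
  \<comment> \<open>\<open>q\<close> collects the inequalities that hold for large \<open>n\<close>;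
    where it fails, \<open>\<epsilon> n = 1\<close> makes the claim trivial.\<close>
  define q where "q n \<longleftrightarrow> 1 \<le> sqrt (ln (real n)) \<and> 1 \<le> ln (ln (real n)) \<and> sqrt (ln (real n)) \<le> n \<and>
    ln (ln (real n)) * ln (real n) powr (1/8) \<le> sqrt (ln (real n)) - 1" for n :: nat
  define e where "e n = exp (sqrt (ln (real n)) * ln (4 * sqrt (ln (real n)))) / n" for n :: nat
  define \<epsilon> where "\<epsilon> n = (if q n then e n else 1)" for n
  have "eventually (\<lambda>n. 1 \<le> sqrt (ln (real n))) sequentially"
    "eventually (\<lambda>n. 1 \<le> ln (ln (real n))) sequentially"
    "eventually (\<lambda>n. sqrt (ln (real n)) \<le> n) sequentially"
    "eventually (\<lambda>n. ln (ln (real n)) * ln (real n) powr (1/8) \<le> sqrt (ln (real n)) - 1) sequentially"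
    by real_asymp+
  hence "eventually q sequentially" unfolding q_def by eventually_elim auto
  hence "eventually (\<lambda>n. e n = \<epsilon> n) sequentially"
    by eventually_elim (simp add: \<epsilon>_def)
  moreover have "e \<longlonglongrightarrow> 0" unfolding e_def by real_asymp
  ultimately have "\<epsilon> \<longlonglongrightarrow> 0" by (rule Lim_transform_eventually[rotated])
  moreover have "measure_pmf.prob (local_search.loads G t n)
      {X. real (max_load G X) \<ge> c * (ln (ln (real n)) / ln (real (max_degree G)))} \<ge> 1 - \<epsilon> n"
    if G: "pair_graph G" "card (pverts G) = n" and t: "valid_tie_rule G t"
    for n and G :: "'a pair_pre_digraph" and t
  proof (cases "q n")
    case False
    thus ?thesis by (simp add: \<epsilon>_def)
  next
    case True
    define D where "D = max_degree G"
    define L where "L = ln (real n)"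
    define x where "x = c * (ln L / ln (real D))"
    define K where "K = nat \<lfloor>x\<rfloor>"
    define m where "m = nat \<lfloor>sqrt L\<rfloor>"
    have q: "1 \<le> sqrt L" "1 \<le> ln L" "sqrt L \<le> n" "ln L * L powr (1/8) \<le> sqrt L - 1"
      using True by (auto simp: q_def L_def)
    have L: "1 \<le> L" using q(1) by simp
    have m: "real m \<le> sqrt L" "sqrt L < real m + 1" "1 \<le> m"
      using q(1) by (auto simp: m_def le_nat_iff le_floor_iff)
    have mn: "m \<le> n" using m q(3) by linarith
    have n: "0 < n" using mn m by simp
    interpret pair_graph G by (rule G)
    have "K * (D + 1) ^ K < m"
    \<comment> \<open>For \<open>D \<le> 1\<close> the denominator \<open>ln D\<close> is 0 (by
      convention at \<open>D = 0\<close>), so the quotient \<open>x\<close> is 0 and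
      \<open>K = 0\<close>.\<close>
    proof (cases "D \<le> 1")
      case True
      hence "D = 0 \<or> D = 1" by auto
      hence "K = 0" by (auto simp: K_def x_def)
      thus ?thesis using m by simp
    next
      case False
      have D: "ln 2 \<le> ln (real D)" "0 < ln (real D)" using False by auto
      have x0: "0 \<le> x" using q D by (simp add: x_def c_def)
      \<comment> \<open>The denominator is bounded away from 0, which gives the crude bound
        \<open>x \<le> ln L\<close> for the factor \<open>K\<close>.\<close>
      have "1 / 2 \<le> ln (2 :: real)" using ln_le_minus_one[of "1 / 2"] by (simp add: ln_div)
      hence "1 / 2 \<le> ln (real D)" using D by linarith
      hence "x \<le> c * (ln L / (1 / 2))" unfolding x_def c_def
        using q D by (intro mult_left_mono divide_left_mono) auto
      also have "\<dots> \<le> ln L" using q by (simp add: c_def)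
      finally have xL: "x \<le> ln L" .
      have Kx: "real K \<le> x" using x0 by (simp add: K_def)
      have "2 * real D \<le> real D * real D" using False by (intro mult_right_mono) auto
      moreover have "real (D + 1) \<le> 2 * real D" using False by simp
      ultimately have "real (D + 1) \<le> (real D)\<^sup>2" unfolding power2_eq_square by linarith
      also have "\<dots> = exp (2 * ln D)" using False by (simp add: exp_double)
      finally have "real (D + 1) \<le> exp (2 * ln D)" .
      hence "real (D + 1) ^ K \<le> exp (2 * ln D) ^ K" by (intro power_mono) auto
      also have "\<dots> = exp (K * (2 * ln D))" by (simp add: exp_of_nat_mult)
      also have "\<dots> \<le> exp (x * (2 * ln D))" using Kx D by simp
      also have "x * (2 * ln D) = 1/8 * ln L" using D by (simp add: x_def c_def)
      also have "exp \<dots> = L powr (1/8)" using L by (simp add: powr_def)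
      finally have "real (D + 1) ^ K \<le> L powr (1/8)" .
      hence "real K * real (D + 1) ^ K \<le> ln L * L powr (1/8)"
        using Kx xL by (intro mult_mono) auto
      also have "\<dots> < real m" using q m by linarith
      finally show ?thesis
        by (metis of_nat_less_iff of_nat_mult of_nat_power)
    qed
    hence "1 - (4 * real m) ^ m / n \<le> measure_pmf.prob (local_search.loads G t n) {X. K < max_load G X}"
      using prob_max_load_gt_single_births[OF t G(2)] mn by (simp add: D_def)
    also have "\<dots> \<le> measure_pmf.prob (local_search.loads G t n) {X. real (max_load G X) \<ge> x}"
      unfolding K_def by (intro measure_pmf.finite_measure_mono)
        (auto simp: floor_less_iff nat_less_iff, linarith)
    finally have *: "1 - (4 * real m) ^ m / n
        \<le> measure_pmf.prob (local_search.loads G t n) {X. real (max_load G X) \<ge> x}" .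
    have "(4 * real m) ^ m = exp (m * ln (4 * real m))"
      using m by (simp add: exp_of_nat_mult)
    also have "\<dots> \<le> exp (sqrt L * ln (4 * sqrt L))"
      using m L by (subst exp_le_cancel_iff, intro mult_mono ln_mono) auto
    finally have "(4 * real m) ^ m / n \<le> \<epsilon> n"
      using True n by (simp add: \<epsilon>_def e_def L_def divide_right_mono)
    thus ?thesis using * by (simp add: x_def L_def D_def)
  qed
  moreover have "c > 0" by (simp add: c_def)
  ultimately show ?thesis by blast
qed

section \<open>Circulant graphs\<close>

text \<open>The Cayley digraph of the integers modulo \<open>n\<close> with connection set
  \<open>J\<close>.\<close>

definition circulant :: "nat \<Rightarrow> nat set \<Rightarrow> nat pair_pre_digraph" where
  "circulant n J = \<lparr>pverts = {..<n}, parcs = {(u, (u + j) mod n) | u j. u < n \<and> j \<in> J}\<rparr>"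

lemma pverts_circulant [simp]: "pverts (circulant n J) = {..<n}"
  by (simp add: circulant_def)

lemma nbrs_circulant: "u < n \<Longrightarrow> nbrs (circulant n J) u = (\<lambda>j. (u + j) mod n) ` J"
  by (auto simp: nbrs_def circulant_def)

text \<open>Closure of \<open>J\<close> under negation modulo \<open>n\<close> makes the arcs
  symmetric; 0 being outside \<open>J\<close> excludes loops.\<close>

lemma pair_graph_circulant:
  assumes J: "J \<subseteq> {1..<n}" "\<And>j. j \<in> J \<Longrightarrow> n - j \<in> J"
  shows "pair_graph (circulant n J)"
proof
  let ?G = "circulant n J"
  have sub: "parcs ?G \<subseteq> {..<n} \<times> {..<n}" by (auto simp: circulant_def)
  show "fst e \<in> pverts ?G" "snd e \<in> pverts ?G" if "e \<in> parcs ?G" for e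
    using sub that by auto
  show "finite (pverts ?G)" by simp
  show "finite (parcs ?G)" using sub by (rule finite_subset) simp
  show "fst e \<noteq> snd e" if e: "e \<in> parcs ?G" for e
  proof
    assume eq: "fst e = snd e"
    obtain u j where u: "e = (u, (u + j) mod n)" "u < n" "j \<in> J"
      using e by (auto simp: circulant_def)
    hence "0 < j" "j < n" using J by auto
    moreover have "(u + j) mod n = u" using eq u by simp
    ultimately show False using \<open>u < n\<close> by (simp add: mod_if split: if_splits)
  qed
  have "(v, u) \<in> parcs ?G" if uv: "(u, v) \<in> parcs ?G" for u v
  proof -
    obtain j where j: "v = (u + j) mod n" "u < n" "j \<in> J"
      using uv by (auto simp: circulant_def)
    hence "j \<le> n" using J by auto
    hence "(v + (n - j)) mod n = (u + n) mod n"
      unfolding j(1) mod_add_left_eq by simp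
    hence "u = (v + (n - j)) mod n" using j by simp
    moreover have "n - j \<in> J" using J j by auto
    moreover have "v < n" using j by simp
    ultimately show ?thesis unfolding circulant_def by auto
  qed
  thus "symmetric (with_proj ?G)" by (auto simp: symmetric_def intro: symI)
qed

text \<open>The jump 1 provides the path 0, 1, ..., n - 1, and symmetry reverses it.\<close>

lemma connected_circulant:
  assumes J: "J \<subseteq> {1..<n}" "\<And>j. j \<in> J \<Longrightarrow> n - j \<in> J" and "1 \<in> J"
  shows "Digraph_Component.connected (with_proj (circulant n J))"
proof -
  let ?G = "circulant n J"
  interpret pair_graph ?G using J by (rule pair_graph_circulant)
  have n: "0 < n" using assms by auto
  have reach: "0 \<rightarrow>\<^sup>*\<^bsub>with_proj ?G\<^esub> v" if "v < n" for v
    using that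
  proof (induction v)
    case (Suc v)
    have "(v, Suc v) \<in> parcs ?G"
      using Suc.prems \<open>1 \<in> J\<close> unfolding circulant_def by (auto intro!: exI[of _ 1])
    thus ?case using Suc by (auto intro: reachable_adj_trans)
  qed (use n in \<open>auto intro: reachable_refl\<close>)
  have "u \<rightarrow>\<^sup>*\<^bsub>with_proj ?G\<^esub> v" if "u < n" "v < n" for u v
    using reach[OF that(1)] reach[OF that(2)] symmetric_reachable[OF sym_arcs]
    by (meson reachable_trans)
  thus ?thesis
    using n by (auto simp: connected_def strongly_connected_def
      reachable_mk_symmetric_eq[OF sym_arcs])
qed

lemma regular_circulant:
  assumes J: "J \<subseteq> {1..<n}" "\<And>j. j \<in> J \<Longrightarrow> n - j \<in> J"
  shows "regular (circulant n J) (card J)"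
proof -
  interpret pair_graph "circulant n J" using J by (rule pair_graph_circulant)
  have "inj_on (\<lambda>j. (u + j) mod n) J" if "u < n" for u
  proof (rule inj_onI)
    fix i j assume ij: "i \<in> J" "j \<in> J" "(u + i) mod n = (u + j) mod n"
    moreover have "i < n" "j < n" using ij J by auto
    ultimately show "i = j" using that by (simp add: mod_if split: if_splits)
  qed
  thus ?thesis
    by (simp add: regular_def out_degree_eq_card_nbrs nbrs_circulant card_image)
qed

section \<open>Jump sets of prescribed size and the growth of arcs\<close>

text \<open>The residues of absolute value 1 to \<open>d div 2\<close>; for odd \<open>d\<close> the
  antipodal jump supplies the missing neighbour.\<close>

definition jumps :: "nat \<Rightarrow> nat \<Rightarrow> nat set" where
  "jumps n d = {1..d div 2} \<union> {n - d div 2..<n} \<union> (if odd d then {n div 2} else {})"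

lemma jumps:
  assumes "2 \<le> d" "d < n" "even (n * d)"
  shows "jumps n d \<subseteq> {1..<n}" "j \<in> jumps n d \<Longrightarrow> n - j \<in> jumps n d"
    "1 \<in> jumps n d" "card (jumps n d) = d"
proof -
  define k where "k = d div 2"
  define h where "h = n div 2"
  have k: "1 \<le> k" "2 * k < n" "k < n - k" using assms by (auto simp: k_def)
  \<comment> \<open>For odd \<open>d\<close> the parity condition makes \<open>n\<close> even, so
    \<open>h\<close> is its own negative; \<open>d < n\<close> puts it strictly between the two
    intervals.\<close>
  have odd: "d = 2 * k + 1" "n = 2 * h" "k < h" if "odd d"
    using that assms by (auto simp: k_def h_def)
  have even: "d = 2 * k" if "even d" using that by (simp add: k_def)
  show "jumps n d \<subseteq> {1..<n}"
    using k odd unfolding jumps_def k_def[symmetric] h_def[symmetric] by auto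
  show "n - j \<in> jumps n d" if "j \<in> jumps n d"
    using that k odd unfolding jumps_def k_def[symmetric] h_def[symmetric]
    by (auto split: if_splits)
  show "1 \<in> jumps n d" using k by (simp add: jumps_def k_def)
  have disj: "{1..k} \<inter> {n - k..<n} = {}" using k by auto
  have c: "card ({1..k} \<union> {n - k..<n}) = 2 * k"
    using k by (subst card_Un_disjoint[OF _ _ disj]) auto
  show "card (jumps n d) = d"
  proof (cases "odd d")
    case True
    have "h \<notin> {1..k} \<union> {n - k..<n}" using odd[OF True] by auto
    thus ?thesis using True odd(1)[OF True] c by (simp add: jumps_def flip: k_def h_def)
  next
    case False
    thus ?thesis using c even by (simp add: jumps_def flip: k_def h_def)
  qed
qed

text \<open>The antipodal jump \<open>n div 2\<close> is an involution commuting with the other jumps, so the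
  neighbourhoods of an arc consist of at most two arcs.\<close>

definition two_arcs :: "nat \<Rightarrow> int \<Rightarrow> int \<Rightarrow> nat set" where
  "two_arcs n a b = (\<lambda>z. nat (z mod int n)) ` ({a..<b} \<union> (\<lambda>z. z + int (n div 2)) ` {a..<b})"

lemma two_arcs_subset: "0 < n \<Longrightarrow> two_arcs n a b \<subseteq> {..<n}"
  by (auto simp: two_arcs_def nat_less_iff)

lemma two_arcs_mono: "a' \<le> a \<Longrightarrow> b \<le> b' \<Longrightarrow> two_arcs n a b \<subseteq> two_arcs n a' b'"
  unfolding two_arcs_def by (intro image_mono Un_mono) auto

lemma card_two_arcs_le: "card (two_arcs n a b) \<le> 2 * nat (b - a)"
proof -
  have "card (two_arcs n a b) \<le> card ({a..<b} \<union> (\<lambda>z. z + int (n div 2)) ` {a..<b})"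
    unfolding two_arcs_def by (rule card_image_le) simp
  also have "\<dots> \<le> card {a..<b} + card ((\<lambda>z. z + int (n div 2)) ` {a..<b})"
    by (rule card_Un_le)
  also have "\<dots> \<le> card {a..<b} + card {a..<b}"
    by (intro add_left_mono card_image_le) simp
  finally show ?thesis by simp
qed

text \<open>A short jump in either direction moves a point by at most \<open>d div 2\<close> within
  its arc, while the antipodal jump exchanges the two arcs. Integer endpoints let arcs extend below
  0.\<close>

lemma nbrs_two_arcs:
  assumes n: "0 < n" "even (n * d)" and u: "u \<in> two_arcs n a b"
  shows "nbrs (circulant n (jumps n d)) u \<subseteq> two_arcs n (a - int (d div 2)) (b + int (d div 2))"
proof
  fix w assume "w \<in> nbrs (circulant n (jumps n d)) u"
  moreover have "u < n" using subsetD[OF two_arcs_subset[OF n(1)] u] by simp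
  ultimately obtain j where j: "j \<in> jumps n d" "w = (u + j) mod n"
    by (auto simp: nbrs_circulant)
  define A where "A = {a - int (d div 2)..<b + int (d div 2)}"
  let ?h = "int (n div 2)"
  have in1: "w \<in> two_arcs n (a - int (d div 2)) (b + int (d div 2))"
    if "int w = y mod int n" "y \<in> A" for y
  proof -
    have "w = nat (y mod int n)" using that(1) by simp
    thus ?thesis using that(2) unfolding two_arcs_def A_def by blast
  qed
  have in2: "w \<in> two_arcs n (a - int (d div 2)) (b + int (d div 2))"
    if "int w = (y + ?h) mod int n" "y \<in> A" for y
  proof -
    have "w = nat ((y + ?h) mod int n)" using that(1) by simp
    thus ?thesis using that(2) unfolding two_arcs_def A_def by blast
  qed
  have w: "int w = (z + int j) mod int n" if "u = nat (z mod int n)" for z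
    using that n j by (simp add: zmod_int mod_add_left_eq)
  obtain y where y: "y \<in> {a..<b}" "u = nat (y mod int n) \<or> u = nat ((y + ?h) mod int n)"
    using u unfolding two_arcs_def by blast
  have w': "int w = (y + int j) mod int n \<or> int w = (y + int j + ?h) mod int n"
    using y(2) w[of y] w[of "y + ?h"] by (auto simp: add_ac)
  consider "j \<in> {1..d div 2}" | "j \<in> {n - d div 2..<n}" | "odd d" "j = n div 2"
    using j(1) by (auto simp: jumps_def split: if_splits)
  thus "w \<in> two_arcs n (a - int (d div 2)) (b + int (d div 2))"
  proof cases
    case 1
    hence A: "y + int j \<in> A" using y by (auto simp: A_def)
    show ?thesis using w' in1[OF _ A] in2[OF _ A] by blast
  next
    case 2
    \<comment> \<open>A jump just below \<open>n\<close> is read as the backward jump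
      \<open>j - n\<close>.\<close>
    hence A: "y + int j - int n \<in> A" using y by (auto simp: A_def)
    have "(y + int j) mod int n = (y + int j - int n) mod int n"
      "(y + int j + ?h) mod int n = (y + int j - int n + ?h) mod int n"
      by (simp, metis add.commute add_diff_eq minus_mod_self2)
    thus ?thesis using w' in1[OF _ A] in2[OF _ A] by metis
  next
    case 3
    have A: "y \<in> A" using y by (auto simp: A_def)
    \<comment> \<open>Two antipodal jumps make a full turn, as \<open>n\<close> is even for odd
      \<open>d\<close>.\<close>
    have "int n = ?h + ?h" using n 3 by (auto elim!: evenE)
    hence "(y + ?h + ?h) mod int n = y mod int n"
      by (metis add.assoc mod_add_self2)
    moreover have "int j = ?h" using 3 by simp
    ultimately show ?thesis using w' in1[OF _ A] in2[OF _ A] by metis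
  qed
qed

section \<open>The lower bound for regular graphs\<close>

text \<open>The arc length \<open>s\<close> exceeds the distance \<open>K * (d div 2)\<close>
  covered in \<open>K\<close> short jumps, so confinement costs only a constant factor in size. Then
  \<open>m / s\<close> is linear in \<open>K\<close> and free of \<open>d\<close>, while
  \<open>m\<close> is of order K^2 d.\<close>

lemma prob_max_load_gt_circulant:
  assumes d: "2 \<le> d" "d < n" "even (n * d)"
    and t: "valid_tie_rule (circulant n (jumps n d)) t"
    and s: "s = (K + 1) * (d div 2)" and m: "m = 6 * (K + 1) * s" "m \<le> n"
  shows "measure_pmf.prob (local_search.loads (circulant n (jumps n d)) t n)
      {X. K < max_load (circulant n (jumps n d)) X}
    \<ge> 1 - (24 * (real K + 1)) ^ m / real (n div s)"
proof -
  let ?G = "circulant n (jumps n d)"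
  interpret pair_graph ?G using jumps[OF d] by (intro pair_graph_circulant) auto
  interpret local_search ?G t by unfold_locales (rule t)
  define k where "k = d div 2"
  define S where "S i = {i * s..<i * s + s}" for i
  define T where "T i r = two_arcs n (int (i * s) - int (r * k)) (int (i * s + s) + int (r * k))" for i r
  have k: "1 \<le> k" using d by (simp add: k_def)
  have s1: "1 \<le> s" using k by (simp add: s k_def)
  have sm: "s \<le> m" by (simp add: m)
  have n: "0 < n" using d by simp
  \<comment> \<open>The arcs \<open>S i\<close> do not wrap around the cycle.\<close>
  have iI: "i * s + s \<le> n" if "i < n div s" for i
  proof -
    have "Suc i * s \<le> (n div s) * s" using that by (intro mult_right_mono) auto
    also have "\<dots> \<le> n" by simp
    finally show ?thesis by simp
  qed
  have "measure_pmf.prob (loads n) {X. K < max_load ?G X}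
      \<ge> 1 - (4 * real m / s) ^ m / card {..<n div s}"
  proof (rule prob_max_load_gt[where S = S and T = T])
    show "{..<n div s} \<noteq> {}" using sm m(2) s1 by (auto simp: div_greater_zero_iff lessThan_empty_iff)
    fix i assume i: "i \<in> {..<n div s}"
    show "S i \<subseteq> T i 0"
    proof
      fix x assume "x \<in> S i"
      hence x: "i * s \<le> x" "x < i * s + s" by (auto simp: S_def)
      hence "x = nat (int x mod int n)" using iI[of i] i by simp
      moreover have "int x \<in> {int (i * s) - int (0 * k)..<int (i * s + s) + int (0 * k)}"
        using x by (simp del: of_nat_mult of_nat_add)
      ultimately show "x \<in> T i 0" unfolding T_def two_arcs_def by blast
    qed
    show "card (S i) = s" by (simp add: S_def)
    show "S i \<inter> S j = {}" if "j \<in> {..<n div s}" "i \<noteq> j" for j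
    proof -
      have "x div s = i" if "x \<in> S i" for x i
        using that s1 unfolding S_def by (intro div_nat_eqI) (auto simp: algebra_simps)
      thus ?thesis using \<open>i \<noteq> j\<close> by blast
    qed
    show "T i r \<subseteq> T i (Suc r)" for r unfolding T_def by (intro two_arcs_mono) auto
    show "nbrs ?G u \<subseteq> T i (Suc r)" if "u \<in> T i r" for r u
      using nbrs_two_arcs[OF n d(3) that[unfolded T_def]]
      unfolding T_def k_def[symmetric] by (simp add: algebra_simps)
    show "T i K \<subseteq> pverts ?G" using two_arcs_subset n by (simp add: T_def)
    \<comment> \<open>There are two arcs, each extended by \<open>K * k \<le> s\<close> at both
      ends.\<close>
    have "card (T i K) \<le> 2 * (s + 2 * (K * k))"
      using card_two_arcs_le[of n "int (i * s) - int (K * k)" "int (i * s + s) + int (K * k)"]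
      unfolding T_def by (simp add: nat_add_distrib nat_mult_distrib)
    also have "\<dots> \<le> 6 * s" by (simp add: s k_def)
    finally have "K * card (T i K) \<le> K * (6 * s)" by (rule mult_left_mono) simp
    also have "\<dots> < m" using s1 by (simp add: m)
    finally show "K * card (T i K) < m" .
  qed (use s1 sm m in auto)
  moreover have "4 * real m / s = 24 * (real K + 1)" using s1 by (simp add: m)
  ultimately show ?thesis by simp
qed

text \<open>In terms of \<kappa> = ln n / d the target is c sqrt(\<kappa> / ln \<kappa>). With
  \<open>K\<close> its integer part, \<open>m\<close> is O(ln n / ln \<kappa>) and the base
  \<open>24 * (K + 1)\<close> is at most sqrt \<kappa>, so the power is at most sqrt n. There are at
  least n / (2 ln n) arcs, which gives an error independent of \<open>d\<close>.\<close>

lemma max_load_ge_sqrt_regular: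
  "\<exists>c>0. \<exists>\<epsilon> :: nat \<Rightarrow> real. \<epsilon> \<longlonglongrightarrow> 0 \<and>
      (\<forall>n d :: nat. 2 \<le> d \<and> real d \<le> ln (real n) / exp 1 \<and> even (n * d) \<longrightarrow>
         (\<exists>G :: nat pair_pre_digraph.
            pair_graph G \<and> Digraph_Component.connected (with_proj G) \<and> card (pverts G) = n \<and>
            regular G d \<and>
            (\<forall>t. valid_tie_rule G t \<longrightarrow>
               measure_pmf.prob (local_search.loads G t n)
                 {X. real (max_load G X) \<ge>
                     c * sqrt (ln (real n) / (real d * ln (ln (real n) / real d)))}
               \<ge> 1 - \<epsilon> n)))"
proof -
  \<comment> \<open>The value 1/48 comes from \<open>24 * (K + 1) \<le> 48 * x\<close>.\<close>
  define c :: real where "c = 1 / 48"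
  define \<epsilon> where "\<epsilon> n = 2 * ln (real n) / sqrt n" for n :: nat
  have "\<epsilon> \<longlonglongrightarrow> 0" unfolding \<epsilon>_def by real_asymp
  moreover have "pair_graph (circulant n (jumps n d)) \<and>
      Digraph_Component.connected (with_proj (circulant n (jumps n d))) \<and>
      card (pverts (circulant n (jumps n d))) = n \<and> regular (circulant n (jumps n d)) d \<and>
      (\<forall>t. valid_tie_rule (circulant n (jumps n d)) t \<longrightarrow>
         measure_pmf.prob (local_search.loads (circulant n (jumps n d)) t n)
           {X. real (max_load (circulant n (jumps n d)) X) \<ge>
               c * sqrt (ln (real n) / (real d * ln (ln (real n) / real d)))} \<ge> 1 - \<epsilon> n)"
    if d: "2 \<le> d" and dn: "real d \<le> ln (real n) / exp 1" and even: "even (n * d)" for n d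
  proof -
    let ?G = "circulant n (jumps n d)"
    define L where "L = ln (real n)"
    define \<kappa> where "\<kappa> = L / d"
    define x where "x = c * sqrt (\<kappa> / ln \<kappa>)"
    have "exp 1 * real d \<le> L" using dn by (simp add: L_def field_simps)
    \<comment> \<open>The upper bound on \<open>d\<close> says exactly that \<kappa> is at least e,
      whence ln \<kappa> \<ge> 1.\<close>
    hence \<kappa>: "exp 1 \<le> \<kappa>" using d by (simp add: \<kappa>_def field_simps)
    have \<kappa>0: "0 < \<kappa>" using \<kappa> by (meson exp_gt_zero order_less_le_trans)
    have ln\<kappa>: "1 \<le> ln \<kappa>" using \<kappa> \<kappa>0 by (simp add: ln_ge_iff)
    have \<kappa>1: "1 < \<kappa>" using ln\<kappa> \<kappa>0 ln_gt_zero_iff[of \<kappa>] by linarith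
    have "1 \<le> exp (1::real)" by simp
    hence "real d \<le> exp 1 * real d" by (simp add: mult_le_cancel_right1)
    hence dL: "real d \<le> L" using \<open>exp 1 * real d \<le> L\<close> by linarith
    hence L: "2 \<le> L" using d by linarith
    have n: "1 < n"
    proof (rule ccontr)
      assume "\<not> 1 < n"
      hence "n = 0 \<or> n = 1" by auto
      thus False using L by (auto simp: L_def)
    qed
    have Ln: "L < n" unfolding L_def using n by (intro ln_less_self) auto
    have "d < n" using dL Ln by linarith
    note J = jumps[OF d this even]
    have G: "pair_graph ?G" using J by (intro pair_graph_circulant) auto
    interpret pair_graph ?G by (rule G)
    have target: "c * sqrt (ln (real n) / (real d * ln (ln (real n) / real d))) = x"
      by (simp add: x_def \<kappa>_def L_def)
    have prob: "measure_pmf.prob (local_search.loads ?G t n) {X. x \<le> real (max_load ?G X)} \<ge> 1 - \<epsilon> n"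
      if t: "valid_tie_rule ?G t" for t
    proof -
      interpret local_search ?G t by unfold_locales (rule t)
      show ?thesis
      \<comment> \<open>A target below 1 asks only for a nonempty bin; otherwise
        \<open>K + 1 \<le> 2 * x\<close> holds.\<close>
      proof (cases "x < 1")
        case True
        have "1 - \<epsilon> n \<le> 1" using L by (simp add: \<epsilon>_def L_def)
        also have "\<dots> = measure_pmf.prob (loads n) {X. 0 < max_load ?G X}"
          using n by (intro prob_max_load_pos[symmetric]) auto
        also have "\<dots> \<le> measure_pmf.prob (loads n) {X. x \<le> real (max_load ?G X)}"
          using True by (intro measure_pmf.finite_measure_mono) auto
        finally show ?thesis .
      next
        case False
        define K where "K = nat \<lfloor>x\<rfloor>"
        define s where "s = (K + 1) * (d div 2)"
        define m where "m = 6 * (K + 1) * s"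
        have K: "real K \<le> x" "x < real K + 1" using False by (auto simp: K_def)
        have K2: "real K + 1 \<le> 2 * x" using K False by linarith
        have "0 \<le> \<kappa> / ln \<kappa>" using \<kappa>0 \<kappa>1 ln\<kappa> by (intro divide_nonneg_nonneg) linarith+
        hence "(sqrt (\<kappa> / ln \<kappa>))\<^sup>2 = \<kappa> / ln \<kappa>" by (rule real_sqrt_pow2)
        hence x2: "x\<^sup>2 = c\<^sup>2 * (\<kappa> / ln \<kappa>)"
          by (simp only: x_def power_mult_distrib)
        have \<kappa>d: "\<kappa> * d = L" using d by (simp add: \<kappa>_def)
        have "real (d div 2) \<le> d / 2" by linarith
        have "real m = 6 * (real K + 1)\<^sup>2 * real (d div 2)"
          by (simp add: m_def s_def power2_eq_square algebra_simps)
        also have "\<dots> \<le> 6 * (2 * x)\<^sup>2 * (d / 2)"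
          using K2 \<open>real (d div 2) \<le> d / 2\<close> by (intro mult_mono power_mono) auto
        also have "\<dots> = 12 * x\<^sup>2 * d" by (simp add: power2_eq_square)
        also have "\<dots> = 12 * c\<^sup>2 * (\<kappa> * d) / ln \<kappa>" unfolding x2 by simp
        finally have m: "real m \<le> 12 * c\<^sup>2 * L / ln \<kappa>" unfolding \<kappa>d .
        also have "\<dots> \<le> 12 * c\<^sup>2 * L / 1" using ln\<kappa> L by (intro divide_left_mono) auto
        also have "\<dots> \<le> L" using L by (simp add: c_def power2_eq_square)
        finally have mL: "real m \<le> L" .
        have mn: "m \<le> n" using mL Ln by linarith
        have s1: "1 \<le> s" using d by (simp add: s_def Suc_le_eq div_greater_zero_iff)
        have "s \<le> m" by (simp add: m_def)
        \<comment> \<open>Rounding in \<open>n div s\<close> costs at most a factor 2, and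
          \<open>s \<le> m \<le> L\<close> then bounds the number of arcs from below.\<close>
        have "n mod s < s" using s1 by simp
        moreover have "s \<le> n" using \<open>s \<le> m\<close> mn by simp
        hence "1 \<le> n div s" using s1 by (simp add: Suc_le_eq div_greater_zero_iff)
        hence "s * 1 \<le> s * (n div s)" by (rule mult_left_mono) simp
        ultimately have "n \<le> 2 * (s * (n div s))" using mult_div_mod_eq[of s n] by linarith
        hence "real n \<le> 2 * (real s * real (n div s))"
          by (metis of_nat_le_iff of_nat_mult of_nat_numeral)
        also have "\<dots> \<le> 2 * (L * real (n div s))"
          using \<open>s \<le> m\<close> mL by (intro mult_left_mono mult_right_mono) auto
        finally have N: "real n / (2 * L) \<le> real (n div s)" using L by (simp add: field_simps)
        have "24 * (real K + 1) \<le> 48 * x" using K2 by simp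
        also have "\<dots> = sqrt (\<kappa> / ln \<kappa>)" by (simp add: x_def c_def)
        also have "\<dots> \<le> sqrt (\<kappa> / 1)"
          using \<kappa>0 \<kappa>1 ln\<kappa> by (intro real_sqrt_le_mono divide_left_mono) auto
        also have "\<dots> = exp (ln \<kappa> / 2)" using \<kappa>0 by (simp flip: ln_sqrt)
        finally have "(24 * (real K + 1)) ^ m \<le> exp (ln \<kappa> / 2) ^ m" by (intro power_mono) auto
        also have "\<dots> = exp (real m * (ln \<kappa> / 2))" by (rule exp_of_nat_mult[symmetric])
        \<comment> \<open>The factor \<open>ln \<kappa>\<close> in the bound on \<open>m\<close>
          cancels the logarithm of the base; this is why it occurs in the target.\<close>
        also have "\<dots> \<le> exp (12 * c\<^sup>2 * L / ln \<kappa> * (ln \<kappa> / 2))"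
          using m \<kappa>1 by (subst exp_le_cancel_iff, intro mult_right_mono) auto
        also have "12 * c\<^sup>2 * L / ln \<kappa> * (ln \<kappa> / 2) = 6 * c\<^sup>2 * L" using ln\<kappa> \<kappa>1 by simp
        also have "exp \<dots> \<le> exp (L / 2)" using L by (simp add: c_def power2_eq_square)
        also have "\<dots> = sqrt n" using n by (simp add: L_def flip: ln_sqrt)
        finally have P: "(24 * (real K + 1)) ^ m \<le> sqrt n" .
        have "(24 * (real K + 1)) ^ m / real (n div s) \<le> sqrt n / (n / (2 * L))"
          using P N n L by (intro frac_le) auto
        also have "\<dots> = \<epsilon> n"
          using n by (simp add: \<epsilon>_def L_def field_simps)
        finally have "1 - \<epsilon> n \<le> 1 - (24 * (real K + 1)) ^ m / real (n div s)" by simp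
        also have "\<dots> \<le> measure_pmf.prob (loads n) {X. K < max_load ?G X}"
          by (rule prob_max_load_gt_circulant[OF d \<open>d < n\<close> even t s_def m_def mn])
        also have "\<dots> \<le> measure_pmf.prob (loads n) {X. x \<le> real (max_load ?G X)}"
          using K by (intro measure_pmf.finite_measure_mono) auto
        finally show ?thesis .
      qed
    qed
    show ?thesis
      using G prob connected_circulant[OF J(1,2,3)] regular_circulant[OF J(1,2)] J(4)
      by (simp add: target)
  qed
  moreover have "c > 0" by (simp add: c_def)
  ultimately show ?thesis by blast
qed

theorem theorem1p6:
  shows
   "(\<exists>c>0. \<exists>\<epsilon> :: nat \<Rightarrow> real. \<epsilon> \<longlonglongrightarrow> 0 \<and>
      (\<forall>n. \<forall>G :: nat pair_pre_digraph.
         pair_graph G \<and> Digraph_Component.connected (with_proj G) \<and> card (pverts G) = n \<longrightarrow>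
         (\<forall>t. valid_tie_rule G t \<longrightarrow>
            measure_pmf.prob (local_search.loads G t n)
              {X. real (max_load G X) \<ge> c * (ln (ln (real n)) / ln (real (max_degree G)))}
            \<ge> 1 - \<epsilon> n)))
    \<and>
    (\<exists>c>0. \<exists>\<epsilon> :: nat \<Rightarrow> real. \<epsilon> \<longlonglongrightarrow> 0 \<and>
      (\<forall>n d :: nat. 2 \<le> d \<and> real d \<le> ln (real n) / exp 1 \<and> even (n * d) \<longrightarrow>
         (\<exists>G :: nat pair_pre_digraph.
            pair_graph G \<and> Digraph_Component.connected (with_proj G) \<and> card (pverts G) = n \<and>
            regular G d \<and>
            (\<forall>t. valid_tie_rule G t \<longrightarrow>
               measure_pmf.prob (local_search.loads G t n)
                 {X. real (max_load G X) \<ge>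
                     c * sqrt (ln (real n) / (real d * ln (ln (real n) / real d)))}
               \<ge> 1 - \<epsilon> n))))"
proof
  show "\<exists>c>0. \<exists>\<epsilon> :: nat \<Rightarrow> real. \<epsilon> \<longlonglongrightarrow> 0 \<and>
      (\<forall>n. \<forall>G :: nat pair_pre_digraph.
         pair_graph G \<and> Digraph_Component.connected (with_proj G) \<and> card (pverts G) = n \<longrightarrow>
         (\<forall>t. valid_tie_rule G t \<longrightarrow>
            measure_pmf.prob (local_search.loads G t n)
              {X. real (max_load G X) \<ge> c * (ln (ln (real n)) / ln (real (max_degree G)))}
            \<ge> 1 - \<epsilon> n))"
    using max_load_ge_ln_ln[where 'a = nat] by meson
qed (rule max_load_ge_sqrt_regular)

end
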